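(* Let $p$ be an odd prime. Then $$\sum_{n=1}^{p-1}\frac{nS_n}{8^n}\equiv0\pmod{p^2}.$$
   Context: For $n\ge0$, $S_n=\sum_{k=0}^{\lfloor n/2\rfloor}\binom{2k}{k}^2\binom{n}{2k}4^{n-2k}=\sum_{k=0}^n\binom{n}{k}\binom{2k}{k}\binom{2n-2k}{n-k}$. Congruences between rationals with denominators prime to $p$ are taken in the ring of such rationals. *)

theory Defs
  imports Complex_Main "HOL-Number_Theory.Number_Theory"
begin

definition S :: "nat \<Rightarrow> nat" where
  "S n = (\<Sum>k = 0..n div 2. ((2 * k) choose k)\<^sup>2 * (n choose (2 * k)) * 4 ^ (n - 2 * k))"

definition p_integral :: "nat \<Rightarrow> rat set" where
  "p_integral p = {x. coprime (snd (quotient_of x)) (int p)}"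

(* The library congruence cong is degenerate over the field rat, so congruence
   modulo m in the ring of p-integral rationals is spelled out: the quotient
   (x - y) / m has to be p-integral as well. *)
definition p_cong :: "nat \<Rightarrow> rat \<Rightarrow> rat \<Rightarrow> nat \<Rightarrow> bool" where
  "p_cong p x y m \<longleftrightarrow>
     x \<in> p_integral p \<and> y \<in> p_integral p \<and> (\<exists>z \<in> p_integral p. x - y = of_nat m * z)"

end

theory Submission
  imports Defs
begin

text \<open>Put \<open>a n = S n / 8 ^ n\<close>.  Creative telescoping in \<open>k\<close> yields the recurrence
  \<open>2 (n + 1)\<^sup>2 a (n + 1) = (3 n\<^sup>2 + 3 n + 1) a n - n\<^sup>2 a (n - 1)\<close>, which is equivalent to
  \<open>n a n = (n + 1)\<^sup>2 (2 a (n + 1) - a n) - n\<^sup>2 (2 a n - a (n - 1))\<close>.  Hence the sum telescopes to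
  \<open>p\<^sup>2 (2 a p - a (p - 1))\<close>, and the second factor is \<open>p\<close>-integral because its denominator
  is a power of 2.\<close>

text \<open>The reduced denominator \<open>d\<close> divides \<open>b\<close>, since
  \<open>a * d = c * b\<close> with \<open>c\<close> and \<open>d\<close> coprime, so it inherits
  coprimality to \<open>p\<close>.\<close>

lemma of_int_divide_in_p_integral:
  assumes "coprime b (int p)" and "b \<noteq> 0"
  shows "of_int a / of_int b \<in> p_integral p"
proof -
  obtain c d where q: "quotient_of (of_int a / of_int b) = (c, d)"
    by (cases "quotient_of (of_int a / of_int b)")
  have "d > 0" "coprime c d" and eq: "(of_int a / of_int b :: rat) = of_int c / of_int d"
    using q quotient_of_denom_pos quotient_of_coprime quotient_of_div by blast+
  then have "(of_int (a * d) :: rat) = of_int (c * b)"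
    using assms(2) by (simp add: field_simps)
  then have "a * d = c * b"
    by (simp only: of_int_eq_iff)
  then have "d dvd b"
    using \<open>coprime c d\<close> by (metis coprime_commute coprime_dvd_mult_right_iff dvd_triv_right)
  then show ?thesis
    using q coprime_divisors[OF _ dvd_refl assms(1)] by (simp add: p_integral_def)
qed

definition scaled_S :: "nat \<Rightarrow> rat" where
  "scaled_S n = of_nat (S n) / 8 ^ n"

text \<open>Because \<open>4 ^ (n - 2 * k) / 8 ^ n\<close> is \<open>1 / (16 ^ k * 2 ^ n)\<close>,
  this weight collects everything in the \<open>k\<close>-th term of \<open>scaled_S n\<close>
  except a binomial in \<open>n\<close> and the factor \<open>1 / 2 ^ n\<close>.\<close>

definition central_weight :: "nat \<Rightarrow> rat" where
  "central_weight k = (of_nat ((2 * k) choose k) / 4 ^ k)\<^sup>2"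

lemma central_weight_Suc:
  "(2 * of_nat k + 2)\<^sup>2 * central_weight (Suc k) = (2 * of_nat k + 1)\<^sup>2 * central_weight k"
proof -
  have "Suc k * ((2 * Suc k) choose Suc k) = 2 * (2 * k + 1) * ((2 * k) choose k)"
  proof -
    have "Suc k * ((2 * Suc k) choose Suc k) = 2 * Suc k * (Suc (2 * k) choose k)"
      using Suc_times_binomial_eq[of "Suc (2 * k)" k] by simp
    moreover have "Suc k * (Suc (2 * k) choose k) = Suc (2 * k) * ((2 * k) choose k)"
      using Suc_times_binomial_eq[of "2 * k" k] binomial_symmetric[of k "Suc (2 * k)"]
      by (simp add: mult.commute)
    ultimately show ?thesis
      by simp
  qed
  \<comment> \<open>Doubling turns \<open>k + 1\<close> into \<open>2 * k + 2\<close>; the 4 on the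
    right is later absorbed by \<open>4 ^ Suc k\<close>.\<close>
  then have "2 * (Suc k * ((2 * Suc k) choose Suc k)) = 4 * ((2 * k + 1) * ((2 * k) choose k))"
    by (simp only: mult.assoc)
  then have "(of_nat (2 * (Suc k * ((2 * Suc k) choose Suc k))) :: rat)
      = of_nat (4 * ((2 * k + 1) * ((2 * k) choose k)))"
    by (simp only:)
  then have "(2 * of_nat k + 2) * (of_nat ((2 * Suc k) choose Suc k) :: rat)
      = 4 * ((2 * of_nat k + 1) * of_nat ((2 * k) choose k))"
    by (simp add: algebra_simps del: binomial_Suc_Suc mult_Suc_right)
  then have "(2 * of_nat k + 2) * (of_nat ((2 * Suc k) choose Suc k) / 4 ^ Suc k :: rat)
      = (2 * of_nat k + 1) * (of_nat ((2 * k) choose k) / 4 ^ k)"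
    by (simp add: divide_simps mult.commute del: binomial_Suc_Suc mult_Suc_right)
  then show ?thesis
    unfolding central_weight_def power_mult_distrib[symmetric] by (rule arg_cong)
qed

text \<open>Terms with \<open>2 * k > n\<close> vanish, so the upper limit is free and consecutive
  values of \<open>n\<close> can share one range of summation.\<close>

lemma scaled_S_eq_sum:
  assumes "n \<le> 2 * K"
  shows "scaled_S n = (\<Sum>k\<le>K. central_weight k * of_nat (n choose (2 * k))) / 2 ^ n"
proof -
  have term_eq: "(of_nat (((2 * k) choose k)\<^sup>2 * (n choose (2 * k)) * 4 ^ (n - 2 * k)) / 8 ^ n :: rat)
      = central_weight k * of_nat (n choose (2 * k)) / 2 ^ n" if "k \<le> n div 2" for k
  proof -
    have "(4 :: rat) ^ n = 4 ^ (n - 2 * k) * (4 ^ k)\<^sup>2"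
      using that by (simp flip: power_add power_mult add: algebra_simps)
    moreover have "(8 :: rat) ^ n = 4 ^ n * 2 ^ n"
      by (simp flip: power_mult_distrib)
    ultimately show ?thesis
      by (simp add: central_weight_def field_simps)
  qed
  have "scaled_S n = (\<Sum>k = 0..n div 2. central_weight k * of_nat (n choose (2 * k)) / 2 ^ n)"
    unfolding scaled_S_def S_def of_nat_sum sum_divide_distrib
    by (rule sum.cong) (use term_eq in auto)
  also have "\<dots> = (\<Sum>k\<le>K. central_weight k * of_nat (n choose (2 * k)) / 2 ^ n)"
    by (rule sum.mono_neutral_left) (use assms in \<open>auto intro!: binomial_eq_0\<close>)
  finally show ?thesis
    by (simp add: sum_divide_distrib)
qed

lemma Suc_mult_Suc_choose_rat:
  "(of_nat j + 1) * of_nat (n choose Suc j) = ((of_nat n - of_nat j) * of_nat (n choose j) :: rat)"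
proof (cases "j \<le> n")
  case True
  have "Suc j * (n choose Suc j) = (n - j) * (n choose j)"
    by (metis binomial_absorb_comp binomial_absorption mult.commute)
  then have "(of_nat (Suc j * (n choose Suc j)) :: rat) = of_nat ((n - j) * (n choose j))"
    by (simp only:)
  with True show ?thesis
    by (simp add: of_nat_diff algebra_simps)
qed (simp add: binomial_eq_0)

text \<open>The right side is shaped for telescoping: at lower index \<open>Suc j = 2 * k\<close>
  its coefficients are \<open>(2 * k)\<^sup>2\<close> and \<open>(2 * k + 1)\<^sup>2\<close>, the
  ones in the recurrence of \<open>central_weight\<close>. The proof reduces every binomial to a
  multiple of \<open>y\<close>, without dividing.\<close>

lemma choose_three_term:
  fixes N j :: nat
  defines "n \<equiv> of_nat N + 1 :: rat"
  shows "(n + 1)\<^sup>2 * of_nat (Suc (Suc N) choose Suc j)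
      - (3 * n\<^sup>2 + 3 * n + 1) * of_nat (Suc N choose Suc j) + 2 * n\<^sup>2 * of_nat (N choose Suc j)
    = (of_nat j + 1)\<^sup>2 * of_nat (Suc N choose j)
      - (of_nat j + 2)\<^sup>2 * of_nat (Suc N choose Suc (Suc j))"
proof -
  define x y z w :: rat where "x = of_nat (Suc N choose j)" and "y = of_nat (Suc N choose Suc j)"
    and "z = of_nat (Suc N choose Suc (Suc j))" and "w = of_nat (N choose Suc j)"
  define i where "i = (of_nat j :: rat)"
  have up: "(of_nat (Suc (Suc N) choose Suc j) :: rat) = x + y"
    by (simp add: x_def y_def)
  have xy: "(i + 1) * y = (n - i) * x"
    using Suc_mult_Suc_choose_rat[of j "Suc N"] by (simp add: x_def y_def n_def i_def algebra_simps)
  have yz: "(i + 2) * z = (n - i - 1) * y"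
    using Suc_mult_Suc_choose_rat[of "Suc j" "Suc N"]
    by (simp add: z_def y_def n_def i_def algebra_simps)
  \<comment> \<open>Pascal's rule and absorption in row \<open>N\<close>; adding
    \<open>(n - i - 1) * w\<close> to both sides of the absorption identity gives the claim.\<close>
  have yw: "n * w = (n - i - 1) * y"
  proof -
    have "y = of_nat (N choose j) + w"
      by (simp add: y_def w_def)
    moreover have "(i + 1) * w = (n - 1 - i) * of_nat (N choose j)"
      using Suc_mult_Suc_choose_rat[of j N] by (simp add: w_def n_def i_def)
    ultimately show ?thesis
      by (simp add: algebra_simps)
  qed
  have "(n + 1)\<^sup>2 * (x + y) - (3 * n\<^sup>2 + 3 * n + 1) * y + 2 * n\<^sup>2 * w
      = (i + 1)\<^sup>2 * x - (i + 2)\<^sup>2 * z"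
  proof -
    \<comment> \<open>The difference of squares factors as \<open>(n - i) * (n + i + 2)\<close>, and
      \<open>xy\<close> trades \<open>(n - i) * x\<close> for a multiple of
      \<open>y\<close>.\<close>
    have "(n + 1)\<^sup>2 * x - (i + 1)\<^sup>2 * x = (n + i + 2) * ((i + 1) * y)"
      unfolding xy by (simp add: algebra_simps power2_eq_square)
    moreover have "(i + 2)\<^sup>2 * z = (i + 2) * ((n - i - 1) * y)"
      unfolding yz[symmetric] by (simp add: power2_eq_square)
    moreover have "2 * n\<^sup>2 * w = 2 * n * ((n - i - 1) * y)"
      unfolding yw[symmetric] by (simp add: power2_eq_square)
    ultimately show ?thesis
      by (simp add: algebra_simps power2_eq_square)
  qed
  then show ?thesis
    unfolding up by (simp only: x_def y_def z_def w_def i_def)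
qed

text \<open>By \<open>central_weight_Suc\<close>, the two parts of consecutive terms cancel, so only
  the upper boundary term survives.\<close>

lemma sum_three_term:
  fixes N K :: nat
  defines "n \<equiv> of_nat N + 1 :: rat"
  shows "(\<Sum>k\<le>K. central_weight k * ((n + 1)\<^sup>2 * of_nat (Suc (Suc N) choose (2 * k))
      - (3 * n\<^sup>2 + 3 * n + 1) * of_nat (Suc N choose (2 * k)) + 2 * n\<^sup>2 * of_nat (N choose (2 * k))))
    = - ((2 * of_nat K + 1)\<^sup>2 * central_weight K) * of_nat (Suc N choose Suc (2 * K))"
proof (induction K)
  case 0
  show ?case
    by (simp add: central_weight_def n_def algebra_simps power2_eq_square)
next
  case (Suc K)
  have "2 * Suc K = Suc (Suc (2 * K))"
    by simp
  then have step: "(n + 1)\<^sup>2 * of_nat (Suc (Suc N) choose (2 * Suc K))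
      - (3 * n\<^sup>2 + 3 * n + 1) * of_nat (Suc N choose (2 * Suc K))
      + 2 * n\<^sup>2 * of_nat (N choose (2 * Suc K))
    = (2 * of_nat K + 2)\<^sup>2 * of_nat (Suc N choose Suc (2 * K))
      - (2 * of_nat (Suc K) + 1)\<^sup>2 * of_nat (Suc N choose Suc (2 * Suc K))"
    using choose_three_term[of N "Suc (2 * K)"]
    by (simp add: n_def algebra_simps del: binomial_Suc_Suc)
  show ?case
    unfolding sum.atMost_Suc Suc.IH step central_weight_Suc[of K, symmetric]
    by (simp add: algebra_simps del: binomial_Suc_Suc)
qed

lemma scaled_S_recurrence:
  fixes N :: nat
  defines "n \<equiv> of_nat N + 1 :: rat"
  shows "2 * (n + 1)\<^sup>2 * scaled_S (Suc (Suc N)) - (3 * n\<^sup>2 + 3 * n + 1) * scaled_S (Suc N)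
    + n\<^sup>2 * scaled_S N = 0"
proof -
  \<comment> \<open>The limit \<open>Suc N\<close> serves all three indices up to
    \<open>N + 2 = 2 * Suc N - N\<close>, and makes the boundary binomial zero.\<close>
  define T :: "nat \<Rightarrow> rat"
    where "T m = (\<Sum>k\<le>Suc N. central_weight k * of_nat (m choose (2 * k)))" for m
  have "(n + 1)\<^sup>2 * T (Suc (Suc N)) - (3 * n\<^sup>2 + 3 * n + 1) * T (Suc N) + 2 * n\<^sup>2 * T N = 0"
    using sum_three_term[of N "Suc N"]
    by (simp add: T_def n_def sum_distrib_left sum.distrib sum_subtractf algebra_simps
        binomial_eq_0 del: binomial_Suc_Suc sum.atMost_Suc)
  moreover have "T m = 2 ^ m * scaled_S m" if "m \<le> Suc (Suc N)" for m
    using scaled_S_eq_sum[of m "Suc N"] that by (simp add: T_def)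
  ultimately have "2 ^ Suc N * (2 * (n + 1)\<^sup>2 * scaled_S (Suc (Suc N))
      - (3 * n\<^sup>2 + 3 * n + 1) * scaled_S (Suc N) + n\<^sup>2 * scaled_S N) = 0"
    by (simp add: algebra_simps)
  then show ?thesis
    by simp
qed

lemma sum_scaled_S:
  "(\<Sum>n = 1..N. of_nat n * scaled_S n) = (of_nat N + 1)\<^sup>2 * (2 * scaled_S (Suc N) - scaled_S N)"
proof (induction N)
  \<comment> \<open>No lower boundary term remains: \<open>S 0 = 1\<close> and
    \<open>S 1 = 4\<close> give \<open>2 * scaled_S 1 = scaled_S 0\<close>.\<close>
  case 0
  show ?case
    by (simp add: scaled_S_def S_def)
next
  case (Suc N)
  then show ?case
    using scaled_S_recurrence[of N] by (simp add: algebra_simps power2_eq_square)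
qed

theorem theorem4p3:
  fixes p :: nat
  assumes "prime p" and "odd p"
  shows "p_cong p (\<Sum>n = 1..p - 1. of_nat (n * S n) / 8 ^ n) 0 (p\<^sup>2)"
proof -
  obtain N where p: "p = Suc N"
    using assms(1) prime_gt_0_nat gr0_conv_Suc by blast
  \<comment> \<open>The numerator over the common denominator \<open>8 ^ p\<close>; the factor 8
    arises because \<open>N = p - 1\<close>.\<close>
  define b :: int where "b = 2 * int (S p) - 8 * int (S N)"
  have "2 * scaled_S p - scaled_S N = of_int b / of_int (8 ^ p)"
    by (simp add: scaled_S_def b_def p field_simps)
  moreover have "(\<Sum>n = 1..p - 1. of_nat (n * S n) / 8 ^ n) = (\<Sum>n = 1..N. of_nat n * scaled_S n)"
    by (simp add: scaled_S_def p)
  moreover have "\<dots> = of_nat (p\<^sup>2) * (2 * scaled_S p - scaled_S N)"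
    by (simp only: sum_scaled_S p) (simp add: add.commute)
  ultimately have sum_eq: "(\<Sum>n = 1..p - 1. of_nat (n * S n) / 8 ^ n)
      = of_nat (p\<^sup>2) * (of_int b / of_int (8 ^ p) :: rat)"
    by (simp only:)
  have "coprime (2 ^ 3 :: int) (int p)"
    using assms(2) by (simp only: coprime_power_left_iff) simp
  then have "coprime (8 ^ p) (int p)"
    by simp
  then have integral: "of_int a / of_int (8 ^ p) \<in> p_integral p" for a
    by (rule of_int_divide_in_p_integral) simp
  \<comment> \<open>\<open>p_cong\<close> also asks that the sum itself be
    \<open>p\<close>-integral; \<open>p\<^sup>2\<close> is moved into the numerator.\<close>
  have "of_nat (p\<^sup>2) * (of_int b / of_int (8 ^ p) :: rat) \<in> p_integral p"
    using integral[of "int (p\<^sup>2) * b"] by simp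
  moreover have "0 \<in> p_integral p"
    using integral[of 0] by simp
  ultimately show ?thesis
    unfolding p_cong_def sum_eq diff_0_right using integral by blast
qed

end
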